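(* Let $P\subset\mathbb{R}^{d}$ be a simple convex polytope, and let $\Lambda\subset\mathbb{R}^{d}$ be a lattice of some rank $m$, $1\leq m\leq d$ (not necessarily of full rank), such that $E(\Lambda)=\{e^{i\langle\lambda,\cdot\rangle}\}_{\lambda\in\Lambda}$ is an infinite set of orthogonal exponentials for $P$, i.e., $\int_{P}e^{i\langle\lambda-\lambda',x\rangle}\,dx=0$ for all distinct $\lambda,\lambda'\in\Lambda$. Then for every $\omega_{0}\in\Lambda\setminus\{0\}$ there exist two distinct vertices $v,v'$ of $P$ and an integer $m'$ such that $\langle\omega_{0},v-v'\rangle=2\pi m'$.
   Context: A convex polytope in $\mathbb{R}^{d}$ is the convex hull of a finite set of points having positive Lebesgue measure; it is simple if each vertex is connected by an edge to exactly $d$ other vertices. A lattice of rank $m$ in $\mathbb{R}^{d}$ is a set of the form $\{\sum_{j=1}^{m}n_{j}b_{j}: n_{j}\in\mathbb{Z}\}$ for $m$ linearly independent vectors $b_{1},\dots,b_{m}\in\mathbb{R}^{d}$. *)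

theory Defs
  imports "HOL-Analysis.Analysis"
begin

definition convex_polytope :: "(real ^ 'd) set \<Rightarrow> bool"
  where "convex_polytope P \<longleftrightarrow> polytope P \<and> emeasure lborel P > 0"

definition simple_convex_polytope :: "(real ^ 'd) set \<Rightarrow> bool"
  where "simple_convex_polytope P \<longleftrightarrow> convex_polytope P \<and>
    (\<forall>v. v extreme_point_of P \<longrightarrow>
      card {w. w extreme_point_of P \<and> w \<noteq> v \<and> closed_segment v w edge_of P} = CARD('d))"

(* The basis is the family b 0, ..., b (m - 1); injectivity is needed because
   "independent" speaks about the set of its values only. *)
definition lattice_of_rank :: "nat \<Rightarrow> (real ^ 'd) set \<Rightarrow> bool"
  where "lattice_of_rank m \<Lambda> \<longleftrightarrow>
    (\<exists>b :: nat \<Rightarrow> real ^ 'd. inj_on b {..<m} \<and> independent (b ` {..<m}) \<and>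
      \<Lambda> = {\<Sum>j<m. real_of_int (n j) *\<^sub>R b j | n :: nat \<Rightarrow> int. True})"

definition expo :: "real ^ 'd \<Rightarrow> real ^ 'd \<Rightarrow> complex"
  where "expo \<mu> x = exp (\<i> * complex_of_real (\<mu> \<bullet> x))"

definition orthogonal_exponentials :: "(real ^ 'd) set \<Rightarrow> (real ^ 'd) set \<Rightarrow> bool"
  where "orthogonal_exponentials P \<Lambda> \<longleftrightarrow>
    (\<forall>\<mu>\<in>\<Lambda>. \<forall>\<mu>'\<in>\<Lambda>. \<mu> \<noteq> \<mu>' \<longrightarrow> (LINT x:P|lborel. expo (\<mu> - \<mu>') x) = 0)"

end

theory Submission
  imports Defs
begin

text \<open>
  Suppose that the numbers \<open>\<omega> \<bullet> v\<close>, for the vertices \<open>v\<close> of \<open>P\<close>, are pairwise distinct modulo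
  \<open>2\<pi>\<close>, and let \<open>f t\<close> be the integral of \<open>exp (\<i> t (\<omega> \<bullet> x))\<close> over \<open>P\<close>. Over a simplex whose vertices
  have distinct values \<open>\<omega> \<bullet> v\<close>, this integral times \<open>t ^ d\<close> is a linear combination, with coefficients
  independent of \<open>t\<close>, of the exponentials \<open>exp (\<i> t (\<omega> \<bullet> v))\<close>. Triangulating \<open>P\<close> without new vertices,
  one obtains \<open>t ^ d * f t = (\<Sum>v. b v * exp (\<i> t (\<omega> \<bullet> v)))\<close>. Orthogonality gives \<open>f k = 0\<close> for all
  integers \<open>k > 0\<close>, that is, all positive power sums of the distinct numbers \<open>exp (\<i> (\<omega> \<bullet> v))\<close> with
  weights \<open>b v\<close> vanish. Hence \<open>b = 0\<close>, so \<open>f\<close> vanishes off \<open>0\<close>, and by continuity \<open>f 0\<close>, the volume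
  of \<open>P\<close>, is zero.
\<close>

section \<open>Regular triangulations\<close>

text \<open>Search on the moment curve: for \<open>h u = r ^ i u\<close> with distinct exponents,
  each sum is the value at \<open>r\<close> of a nonzero polynomial, so only finitely many
  \<open>r\<close> are bad.\<close>

lemma exists_vector_avoiding_hyperplanes:
  fixes A :: "('a \<Rightarrow> real) set"
  assumes V: "finite V" and A: "finite A" "\<And>a. a \<in> A \<Longrightarrow> \<exists>u\<in>V. a u \<noteq> 0"
  shows "\<exists>h. \<forall>a\<in>A. (\<Sum>u\<in>V. a u * h u) \<noteq> 0"
proof -
  obtain i :: "'a \<Rightarrow> nat" where i: "inj_on i V"
    using finite_imp_inj_to_nat_seg[OF V] by blast
  define p where "p a = (\<Sum>u\<in>V. monom (a u) (i u))" for a :: "'a \<Rightarrow> real"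
  have "p a \<noteq> 0" if aA: "a \<in> A" for a
  proof -
    obtain u where u: "u \<in> V" "a u \<noteq> 0"
      using A(2)[OF aA] by blast
    have "coeff (p a) (i u) = (\<Sum>v\<in>V. if v = u then a v else 0)"
      unfolding p_def coeff_sum coeff_monom
      by (intro sum.cong) (use i u(1) in \<open>auto simp: inj_on_def\<close>)
    with u V show ?thesis
      by auto
  qed
  then have "finite (\<Union>a\<in>A. {r. poly (p a) r = 0})"
    using A(1) by (auto intro!: poly_roots_finite)
  then obtain r where "r \<notin> (\<Union>a\<in>A. {r. poly (p a) r = 0})"
    using ex_new_if_finite infinite_UNIV_char_0 by blast
  then show ?thesis
    by (intro exI[of _ "\<lambda>u. r ^ i u"]) (auto simp: p_def poly_sum poly_monom)
qed

lemma affine_coordinates_unique: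
  fixes T :: "'a::real_vector set"
  assumes "finite T" "\<not> affine_dependent T" "sum \<mu> T = sum \<nu> T"
    "(\<Sum>u\<in>T. \<mu> u *\<^sub>R u) = (\<Sum>u\<in>T. \<nu> u *\<^sub>R u)" "u \<in> T"
  shows "\<mu> u = \<nu> u"
proof (rule ccontr)
  assume "\<mu> u \<noteq> \<nu> u"
  then have "affine_dependent T"
    unfolding affine_dependent_explicit_finite[OF assms(1)]
    using assms by (intro exI[of _ "\<lambda>u. \<mu> u - \<nu> u"])
      (auto simp: sum_subtractf scaleR_left_diff_distrib)
  with assms show False by blast
qed

text \<open>Genericity means that no lifted point \<open>(w, h w)\<close> lies in the affine hull of
  the lifted points over an affinely independent \<open>T\<close>. As affine coordinates are unique,
  each pair \<open>(T, w)\<close> excludes just one hyperplane of vectors \<open>h\<close>.\<close>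

lemma exists_generic_heights:
  fixes V :: "'a::real_vector set"
  assumes V: "finite V"
  shows "\<exists>h. \<forall>T w \<mu>. T \<subseteq> V \<longrightarrow> \<not> affine_dependent T \<longrightarrow> w \<in> V - T \<longrightarrow> sum \<mu> T = 1 \<longrightarrow>
           (\<Sum>u\<in>T. \<mu> u *\<^sub>R u) = w \<longrightarrow> (\<Sum>u\<in>T. \<mu> u * h u) \<noteq> (h w :: real)"
proof -
  \<comment> \<open>If \<open>w\<close> has no affine coordinates over \<open>T\<close>, the choice
    is arbitrary. This is harmless: \<open>a (T, w)\<close> still has the entry 1 at
    \<open>w\<close>, so it is a nonzero functional.\<close>
  define M where "M T w = (SOME \<mu>::'a\<Rightarrow>real. sum \<mu> T = 1 \<and> (\<Sum>u\<in>T. \<mu> u *\<^sub>R u) = w)" for T w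
  define a where "a = (\<lambda>(T, w) u. if u = w then 1 else if u \<in> T then - M T w u else 0)"
  have "finite (a ` (Pow V \<times> V))"
    using V by auto
  moreover have "\<exists>u\<in>V. f u \<noteq> 0" if "f \<in> a ` (Pow V \<times> V)" for f
    using that by (force simp: a_def)
  ultimately obtain h where h: "\<forall>f\<in>a ` (Pow V \<times> V). (\<Sum>u\<in>V. f u * h u) \<noteq> 0"
    using exists_vector_avoiding_hyperplanes[OF V] by blast
  show ?thesis
  proof (intro exI[of _ h] allI impI)
    fix T w \<mu>
    assume T: "T \<subseteq> V" "\<not> affine_dependent T" "w \<in> V - T" and \<mu>: "sum \<mu> T = 1" "(\<Sum>u\<in>T. \<mu> u *\<^sub>R u) = w"
    have "sum (M T w) T = 1 \<and> (\<Sum>u\<in>T. M T w u *\<^sub>R u) = w"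
      unfolding M_def by (rule someI[of _ \<mu>]) (use \<mu> in blast)
    then have eq: "M T w u = \<mu> u" if "u \<in> T" for u
      using affine_coordinates_unique[of T "M T w" \<mu> u] T V \<mu> that finite_subset by auto
    have "(\<Sum>u\<in>V. a (T, w) u * h u) = (\<Sum>u\<in>insert w T. a (T, w) u * h u)"
      by (rule sum.mono_neutral_right) (use T V in \<open>auto simp: a_def\<close>)
    also have "\<dots> = h w + (\<Sum>u\<in>T. a (T, w) u * h u)"
      using T V finite_subset by (subst sum.insert) (auto simp: a_def)
    also have "(\<Sum>u\<in>T. a (T, w) u * h u) = (\<Sum>u\<in>T. - (\<mu> u * h u))"
      using T(3) eq by (intro sum.cong) (auto simp: a_def)
    finally have "(\<Sum>u\<in>V. a (T, w) u * h u) = h w - (\<Sum>u\<in>T. \<mu> u * h u)"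
      by (simp add: sum_negf)
    moreover have "a (T, w) \<in> a ` (Pow V \<times> V)"
      using T by auto
    ultimately show "(\<Sum>u\<in>T. \<mu> u * h u) \<noteq> h w"
      using h by fastforce
  qed
qed

text \<open>Subtracting a base point of \<open>T\<close> turns the other points into independent
  vectors, on which a linear map may be prescribed; \<open>c\<close> then adjusts the value at the
  base point.\<close>

lemma exists_affine_interpolation:
  fixes T :: "'a::euclidean_space set"
  assumes T: "\<not> affine_dependent T"
  shows "\<exists>(\<phi>::'a \<Rightarrow> real) c. linear \<phi> \<and> (\<forall>u\<in>T. \<phi> u + c = h u)"
proof (cases "T = {}")
  case True
  then show ?thesis
    using module_hom_zero linear_zero by fastforce
next
  case False
  then obtain a where a: "a \<in> T" by blast
  then have "independent ((\<lambda>x. -a + x) ` (T - {a}))"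
    using T affine_dependent_iff_dependent2 by blast
  then obtain \<phi> :: "'a \<Rightarrow> real" where \<phi>: "linear \<phi>"
      "\<forall>x\<in>(\<lambda>x. -a + x) ` (T - {a}). \<phi> x = h (a + x) - h a"
    using linear_independent_extend[where f = "\<lambda>x. h (a + x) - h a"] by blast
  have "\<phi> u + (h a - \<phi> a) = h u" if "u \<in> T" for u
  proof (cases "u = a")
    case False
    then have "\<phi> (-a + u) = h u - h a"
      using \<phi>(2) that by auto
    then show ?thesis
      using linear_add[OF \<phi>(1), of "-a" u] linear_neg[OF \<phi>(1), of a] by simp
  qed simp
  with \<phi>(1) show ?thesis by blast
qed

lemma affine_combination_affine_map:
  fixes \<phi> :: "'a::real_vector \<Rightarrow> real"
  assumes "linear \<phi>" "sum \<mu> T = 1" "(\<Sum>u\<in>T. \<mu> u *\<^sub>R u) = x"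
  shows "\<phi> x + c = (\<Sum>u\<in>T. \<mu> u * (\<phi> u + c))"
proof -
  have "\<phi> x = (\<Sum>u\<in>T. \<mu> u * \<phi> u)"
    by (simp add: assms(3)[symmetric] linear_sum[OF assms(1)] linear_scale[OF assms(1)])
  then show ?thesis
    using assms(2) by (simp add: distrib_left sum.distrib flip: sum_distrib_right)
qed

text \<open>A regular triangulation: its simplices are the projections of the lower facets of the
  polytope spanned by the points \<open>(v, h v)\<close>, for generic heights \<open>h\<close>. A simplex over a generic point
  which is lowest there must be such a facet, as otherwise a pivot step of the simplex algorithm
  would produce a lower one.\<close>

lemma regular_triangulation:
  fixes V :: "'a::euclidean_space set"
  assumes V: "finite V"
  obtains \<T> N where "\<And>T. T \<in> \<T> \<Longrightarrow> T \<subseteq> V \<and> \<not> affine_dependent T \<and> card T = Suc DIM('a)"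
    "N \<in> null_sets lborel"
    "\<And>x T T'. \<lbrakk>T \<in> \<T>; T' \<in> \<T>; x \<in> convex hull T; x \<in> convex hull T'; x \<notin> N\<rbrakk> \<Longrightarrow> T = T'"
    "\<And>x. \<lbrakk>x \<in> convex hull V; x \<notin> N\<rbrakk> \<Longrightarrow> \<exists>T\<in>\<T>. x \<in> convex hull T"
proof -
  obtain h :: "'a \<Rightarrow> real" where h: "\<And>T w \<mu>. \<lbrakk>T \<subseteq> V; \<not> affine_dependent T; w \<in> V - T; sum \<mu> T = 1;
           (\<Sum>u\<in>T. \<mu> u *\<^sub>R u) = w\<rbrakk> \<Longrightarrow> (\<Sum>u\<in>T. \<mu> u * h u) \<noteq> h w"
    using exists_generic_heights[OF V] by blast
  define basis where "basis T \<longleftrightarrow> T \<subseteq> V \<and> \<not> affine_dependent T \<and> card T = Suc DIM('a)" for T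
  \<comment> \<open>Points off \<open>N\<close> are generic: no subset of \<open>V\<close> whose
    convex hull contains such a point has deficient dimension.\<close>
  define N where "N = (\<Union>T\<in>{T\<in>Pow V. aff_dim T < DIM('a)}. affine hull T)"
  define \<T> where "\<T> = {T. basis T \<and>
    (\<exists>\<phi> c. linear \<phi> \<and> (\<forall>u\<in>T. \<phi> u + c = h u) \<and> (\<forall>w\<in>V - T. \<phi> w + c < h w))}"
  have fin: "finite T" if "T \<subseteq> V" for T
    using V that finite_subset by blast
  have N: "N \<in> null_sets lborel"
    unfolding N_def
  proof (rule null_sets_UN')
    show "countable {T \<in> Pow V. aff_dim T < int DIM('a)}"
      using V by (intro countable_finite) auto
    fix T assume T: "T \<in> {T \<in> Pow V. aff_dim T < int DIM('a)}"
    have "interior (affine hull T) = {}"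
      using T by (intro low_dim_interior) auto
    \<comment> \<open>A closed set with empty interior is its own frontier, and the frontier of a
      convex set is negligible.\<close>
    then have "negligible (affine hull T)"
      by (metis affine_imp_convex affine_affine_hull closure_closed closed_affine_hull
          frontier_def Diff_empty negligible_convex_frontier)
    then show "affine hull T \<in> null_sets lborel"
      by (simp add: negligible_iff_null_sets null_sets_completion_iff closed_affine_hull)
  qed
  have basisI: "basis T" if "x \<notin> N" "T \<subseteq> V" "card T \<le> Suc DIM('a)" "x \<in> convex hull T" for x T
  proof -
    have "\<not> aff_dim T < DIM('a)"
      using that convex_hull_subset_affine_hull[of T] by (auto simp: N_def)
    moreover have "aff_dim T \<le> int (card T) - 1"
      using aff_dim_le_card[OF fin[OF that(2)]] .
    ultimately have "card T = Suc DIM('a)" "aff_dim T = int (card T) - 1"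
      using that(3) by linarith+
    then show ?thesis
      using that fin by (auto simp: basis_def affine_independent_iff_card)
  qed
  \<comment> \<open>A zero coefficient would allow \<open>u\<close> to be dropped, leaving a generic
    point in the hull of at most \<open>DIM('a)\<close> points, which \<open>basisI\<close> rules
    out.\<close>
  have pos: "l u > 0" if "x \<notin> N" "T \<subseteq> V" "card T \<le> Suc DIM('a)" "\<forall>u\<in>T. 0 \<le> l u" "sum l T = 1"
    "(\<Sum>u\<in>T. l u *\<^sub>R u) = x" "u \<in> T" for x T l u
  proof (rule ccontr)
    assume "\<not> l u > 0"
    then have 0: "l u = 0"
      using that by force
    note finT = fin[OF that(2)]
    have "x \<in> convex hull (T - {u})"
      unfolding convex_hull_finite[OF finite_Diff[OF finT]]
      using that finT 0 by (auto intro!: exI[of _ l] simp: sum_diff1)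
    then have "basis (T - {u})"
      using that finT by (intro basisI[of x]) auto
    then show False
      using that finT by (auto simp: basis_def)
  qed
  \<comment> \<open>The second affine function is at most \<open>h\<close> on \<open>V\<close>, with
    equality only on \<open>T'\<close>. Averaging over \<open>T\<close> with the positive
    coordinates of \<open>x\<close> gives a strict inequality because some vertex of
    \<open>T\<close> lies outside \<open>T'\<close>.\<close>
  have below: "\<phi>' x + c' < \<phi> x + c"
    if x: "x \<notin> N" "x \<in> convex hull T" and T: "basis T" "\<not> T \<subseteq> T'"
      and \<phi>: "linear \<phi>" "\<forall>u\<in>T. \<phi> u + c = h u"
      and \<phi>': "linear \<phi>'" "\<forall>u\<in>T'. \<phi>' u + c' = h u" "\<forall>w\<in>V - T'. \<phi>' w + c' < h w"
    for x T T' \<phi> \<phi>' c c'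
  proof -
    have TV: "T \<subseteq> V" "finite T"
      using T(1) fin by (auto simp: basis_def)
    obtain l where l: "\<forall>u\<in>T. 0 \<le> l u" "sum l T = 1" "(\<Sum>u\<in>T. l u *\<^sub>R u) = x"
      using x(2) unfolding convex_hull_finite[OF TV(2)] by blast
    have lpos: "l u > 0" if "u \<in> T" for u
      using pos[OF x(1) TV(1) _ l that] T(1) by (simp add: basis_def)
    have le: "\<phi>' u + c' \<le> h u" if "u \<in> T" for u
      using \<phi>'(2,3) TV(1) that by (cases "u \<in> T'") force+
    obtain a where a: "a \<in> T" "a \<notin> T'"
      using T(2) by blast
    have "\<phi>' x + c' = (\<Sum>u\<in>T. l u * (\<phi>' u + c'))"
      using affine_combination_affine_map[OF \<phi>'(1) l(2,3)] .
    also have "\<dots> < (\<Sum>u\<in>T. l u * h u)"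
    proof (rule sum_strict_mono_ex1[OF TV(2)])
      show "\<forall>u\<in>T. l u * (\<phi>' u + c') \<le> l u * h u"
        using le l(1) mult_left_mono by blast
      show "\<exists>u\<in>T. l u * (\<phi>' u + c') < l u * h u"
        using a lpos[OF a(1)] \<phi>'(3) TV(1) by (intro bexI[of _ a]) auto
    qed
    also have "\<dots> = (\<Sum>u\<in>T. l u * (\<phi> u + c))"
      using \<phi>(2) by (intro sum.cong) auto
    also have "\<dots> = \<phi> x + c"
      using affine_combination_affine_map[OF \<phi>(1) l(2,3)] by simp
    finally show ?thesis .
  qed
  have unique: "T = T'"
    if T: "T \<in> \<T>" "T' \<in> \<T>" and x: "x \<in> convex hull T" "x \<in> convex hull T'" "x \<notin> N" for x T T'
  proof (rule ccontr)
    assume neq: "T \<noteq> T'"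
    obtain \<phi> c where \<phi>: "linear \<phi>" "\<forall>u\<in>T. \<phi> u + c = h u" "\<forall>w\<in>V - T. \<phi> w + c < h w"
      using T(1) by (auto simp: \<T>_def)
    obtain \<phi>' c' where \<phi>': "linear \<phi>'" "\<forall>u\<in>T'. \<phi>' u + c' = h u" "\<forall>w\<in>V - T'. \<phi>' w + c' < h w"
      using T(2) by (auto simp: \<T>_def)
    have b: "basis T" "basis T'"
      using T by (auto simp: \<T>_def)
    \<comment> \<open>Distinct sets of equal finite size are not nested, so \<open>below\<close>
      applies in both directions and each affine function would be strictly below the other at
      \<open>x\<close>.\<close>
    then have "\<not> T \<subseteq> T'" "\<not> T' \<subseteq> T"
      using neq fin card_subset_eq unfolding basis_def by metis+
    then show False
      using below[OF x(3,1) b(1) _ \<phi>(1,2) \<phi>'] below[OF x(3,2) b(2) _ \<phi>'(1,2) \<phi>] by linarith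
  qed
  have exists: "\<exists>T\<in>\<T>. x \<in> convex hull T" if x: "x \<in> convex hull V" "x \<notin> N" for x
  proof -
    have "\<forall>T. \<exists>f. \<not> affine_dependent T \<longrightarrow>
        (\<exists>\<phi> c. linear \<phi> \<and> f = (\<lambda>x. \<phi> x + c) \<and> (\<forall>u\<in>T. \<phi> u + c = h u))"
      using exists_affine_interpolation[of _ h] by fastforce
    then obtain L where L: "\<And>T. \<not> affine_dependent T \<Longrightarrow>
        \<exists>\<phi> c. linear \<phi> \<and> L T = (\<lambda>x. \<phi> x + c) \<and> (\<forall>u\<in>T. \<phi> u + c = h u)"
      by metis
    have L_comb: "L T y = (\<Sum>u\<in>T. \<mu> u * h u)"
      if T: "\<not> affine_dependent T" and \<mu>: "sum \<mu> T = 1" "(\<Sum>u\<in>T. \<mu> u *\<^sub>R u) = y" for T \<mu> y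
    proof -
      obtain \<phi> c where \<phi>: "linear \<phi>" "L T = (\<lambda>x. \<phi> x + c)" "\<forall>u\<in>T. \<phi> u + c = h u"
        using L[OF T] by blast
      show ?thesis
        using affine_combination_affine_map[OF \<phi>(1) \<mu>, of c] \<phi>(2,3) by simp
    qed
    \<comment> \<open>Caratheodory's theorem and \<open>basisI\<close> show that some
      full-dimensional simplex contains \<open>x\<close>. Among these finitely many candidates,
      \<open>T\<close> is taken to minimize \<open>L T x\<close>, the height of the lifted simplex
      above \<open>x\<close>.\<close>
    define C where "C = {T. basis T \<and> x \<in> convex hull T}"
    have "finite C"
      by (rule finite_subset[of _ "Pow V"]) (use V in \<open>auto simp: C_def basis_def\<close>)
    moreover have "C \<noteq> {}"
      using x(1) basisI[OF x(2)] unfolding caratheodory[of V] by (auto simp: C_def)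
    ultimately obtain T where T: "T \<in> C" and T_min: "\<And>T'. T' \<in> C \<Longrightarrow> L T x \<le> L T' x"
      using ex_min_if_finite[of "(\<lambda>T. L T x) ` C"] by (force simp: not_less)
    have bT: "T \<subseteq> V" "\<not> affine_dependent T" "card T = Suc DIM('a)" "basis T"
      and xT: "x \<in> convex hull T"
      using T by (auto simp: C_def basis_def)
    note finT = fin[OF bT(1)]
    obtain l where l: "\<forall>u\<in>T. 0 \<le> l u" "sum l T = 1" "(\<Sum>u\<in>T. l u *\<^sub>R u) = x"
      using xT unfolding convex_hull_finite[OF finT] by blast
    have lpos: "l u > 0" if "u \<in> T" for u
      using pos[OF x(2) bT(1) _ l that] bT(3) by simp
    have lower: "L T w < h w" if w: "w \<in> V - T" for w
    proof (rule ccontr)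
      assume not_less: "\<not> L T w < h w"
      have "affine hull T = UNIV"
        using bT finT by (intro affine_independent_span_eq) auto
      then obtain \<mu> where \<mu>: "sum \<mu> T = 1" "(\<Sum>u\<in>T. \<mu> u *\<^sub>R u) = w"
        unfolding affine_hull_finite[OF finT] by blast
      \<comment> \<open>Generic heights exclude equality. The strict inequality is what makes the
        pivot below decrease the height.\<close>
      have gt: "h w < L T w"
        using not_less h[OF bT(1,2) w \<mu>] L_comb[OF bT(2) \<mu>] by linarith
      define U where "U = {u\<in>T. \<mu> u > 0}"
      have "U \<noteq> {}"
      proof
        assume "U = {}"
        then have "sum \<mu> T \<le> 0"
          by (intro sum_nonpos) (auto simp: U_def not_less)
        then show False using \<mu> by simp
      qed
      moreover have "finite U"
        using finT by (simp add: U_def)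
      ultimately obtain a where a: "a \<in> U" "\<And>u. u \<in> U \<Longrightarrow> l a / \<mu> a \<le> l u / \<mu> u"
        using ex_min_if_finite[of "(\<lambda>u. l u / \<mu> u) ` U"] by (force simp: not_less)
      \<comment> \<open>The ratio test of the simplex algorithm: \<open>s\<close> is the largest
        weight that can be moved onto \<open>w\<close> while the coordinates over \<open>T\<close>
        stay nonnegative, and \<open>a\<close> is a vertex whose coordinate then reaches
        zero.\<close>
      define s where "s = l a / \<mu> a"
      define l' where "l' u = (if u = w then s else l u - s * \<mu> u)" for u
      define T' where "T' = insert w (T - {a})"
      have aT: "a \<in> T" "\<mu> a > 0" and s: "s > 0"
        using a(1) lpos by (auto simp: U_def s_def)
      \<comment> \<open>This identity is used for three choices of \<open>f\<close>: the constant 1,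
        the identity and \<open>h\<close> yield the total weight, the represented point and the
        height after the pivot.\<close>
      have sum_l': "(\<Sum>u\<in>T'. l' u *\<^sub>R f u) = (\<Sum>u\<in>T. l u *\<^sub>R f u) - s *\<^sub>R (\<Sum>u\<in>T. \<mu> u *\<^sub>R f u) + s *\<^sub>R f w"
        for f :: "'a \<Rightarrow> 'b::real_vector"
      proof -
        have "(\<Sum>u\<in>T'. l' u *\<^sub>R f u) = s *\<^sub>R f w + (\<Sum>u\<in>T - {a}. (l u - s * \<mu> u) *\<^sub>R f u)"
          unfolding T'_def using finT w
          by (subst sum.insert) (auto simp: l'_def intro!: sum.cong split: if_splits)
        \<comment> \<open>The term of \<open>a\<close> may be restored because
          \<open>l a - s * \<mu> a\<close> is zero.\<close>
        also have "(\<Sum>u\<in>T - {a}. (l u - s * \<mu> u) *\<^sub>R f u) = (\<Sum>u\<in>T. (l u - s * \<mu> u) *\<^sub>R f u)"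
          using finT aT by (subst sum_diff1) (auto simp: s_def)
        finally show ?thesis
          by (simp add: scaleR_left_diff_distrib sum_subtractf scaleR_sum_right)
      qed
      have l': "sum l' T' = 1" "(\<Sum>u\<in>T'. l' u *\<^sub>R u) = x"
        using sum_l'[of "\<lambda>_. 1 :: real"] sum_l'[of "\<lambda>u. u"] l \<mu> by simp_all
      have l'_nonneg: "l' u \<ge> 0" if "u \<in> T'" for u
      proof (cases "u = w")
        case True
        then show ?thesis using s by (simp add: l'_def)
      next
        case False
        then have u: "u \<in> T"
          using that by (auto simp: T'_def)
        have "s * \<mu> u \<le> l u"
        proof (cases "\<mu> u > 0")
          case True
          then show ?thesis
            using a(2)[of u] u by (simp add: U_def s_def pos_le_divide_eq)
        next
          case False
          then have "s * \<mu> u \<le> 0"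
            using s by (simp add: mult_nonneg_nonpos)
          also have "\<dots> \<le> l u"
            using l(1) u by blast
          finally show ?thesis .
        qed
        with False show ?thesis by (simp add: l'_def)
      qed
      have T'V: "T' \<subseteq> V" and cardT': "card T' = card T"
        using w bT(1) aT finT card_Suc_Diff1[OF finT aT(1)] by (auto simp: T'_def)
      have "x \<in> convex hull T'"
        unfolding convex_hull_finite[OF fin[OF T'V]] using l' l'_nonneg by blast
      then have T'C: "T' \<in> C" and T'_indep: "\<not> affine_dependent T'"
        using basisI[OF x(2) T'V] cardT' bT(3) by (auto simp: C_def basis_def)
      have "L T' x = L T x - s * L T w + s * h w"
        using L_comb[OF T'_indep l'] L_comb[OF bT(2) l(2,3)] L_comb[OF bT(2) \<mu>] sum_l'[of h] by simp
      also have "\<dots> < L T x"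
        using gt s by simp
      finally show False
        using T_min[OF T'C] by simp
    qed
    obtain \<phi> c where "linear \<phi>" "L T = (\<lambda>x. \<phi> x + c)" "\<forall>u\<in>T. \<phi> u + c = h u"
      using L[OF bT(2)] by blast
    then have "T \<in> \<T>"
      unfolding \<T>_def using lower bT(4) by (intro CollectI conjI exI[of _ \<phi>] exI[of _ c]) auto
    with xT show ?thesis by blast
  qed
  show thesis
    using that[OF _ N unique exists] by (simp add: \<T>_def basis_def)
qed

section \<open>Linear images of Lebesgue measure\<close>

text \<open>The Jacobian factor is \<open>\<bar>c\<bar> ^ DIM('a)\<close>, hence 1. The cases
  \<open>c = 1\<close> and \<open>c = - 1\<close> are the substitutions in the Fubini argument
  below.\<close>

lemma nn_integral_lborel_translate_reflect:
  fixes f :: "'a::euclidean_space \<Rightarrow> ennreal"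
  assumes [measurable]: "f \<in> borel_measurable borel" and c: "\<bar>c\<bar> = 1"
  shows "(\<integral>\<^sup>+y. f (t + c *\<^sub>R y) \<partial>lborel) = (\<integral>\<^sup>+y. f y \<partial>lborel)"
proof -
  have "c \<noteq> 0" using c by auto
  have "(\<integral>\<^sup>+y. f y \<partial>lborel) =
      (\<integral>\<^sup>+y. f y \<partial>density (distr lborel borel (\<lambda>x. t + c *\<^sub>R x)) (\<lambda>_. \<bar>c\<bar> ^ DIM('a)))"
    using lborel_affine[OF \<open>c \<noteq> 0\<close>, of t] by simp
  also have "\<dots> = (\<integral>\<^sup>+y. f (t + c *\<^sub>R y) \<partial>lborel)"
    using c by (simp add: nn_integral_density nn_integral_distr)
  finally show ?thesis by simp
qed

text \<open>Uniqueness of the Haar measure, proved with Fubini's theorem: integrating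
  \<open>1\<^sub>E (g z) * 1\<^sub>F (g z + y)\<close> in either order shows that the push-forward of the Lebesgue measure
  under \<open>g\<close> is proportional to the Lebesgue measure.\<close>

lemma distr_lborel_linear:
  fixes g h :: "'a::euclidean_space \<Rightarrow> 'a"
  assumes g: "linear g" and h: "linear h" and gh: "\<And>x. g (h x) = x" and hg: "\<And>x. h (g x) = x"
  obtains c where "c \<ge> 0" "distr lborel borel g = density lborel (\<lambda>_. ennreal c)"
proof -
  have [measurable]: "g \<in> borel_measurable borel" "h \<in> borel_measurable borel"
    using g h by (auto intro!: borel_measurable_continuous_onI linear_continuous_on
        simp: linear_conv_bounded_linear)
  let ?\<mu> = "\<lambda>E. \<integral>\<^sup>+z. indicator E (g z) \<partial>lborel"
  have proportional: "?\<mu> E * emeasure lborel F = ?\<mu> F * emeasure lborel E"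
    if [measurable]: "E \<in> sets borel" "F \<in> sets borel" for E F :: "'a set"
  proof -
    have "?\<mu> E * emeasure lborel F =
        (\<integral>\<^sup>+z. indicator E (g z) * (\<integral>\<^sup>+y. indicator F (g z + 1 *\<^sub>R y) \<partial>lborel) \<partial>lborel)"
      by (subst nn_integral_lborel_translate_reflect) (simp_all add: nn_integral_multc)
    also have "\<dots> = (\<integral>\<^sup>+z. \<integral>\<^sup>+y. indicator E (g z) * indicator F (g z + y) \<partial>lborel \<partial>lborel)"
      by (simp add: nn_integral_cmult)
    also have "\<dots> = (\<integral>\<^sup>+y. \<integral>\<^sup>+z. indicator E (g z) * indicator F (g z + y) \<partial>lborel \<partial>lborel)"
      by (rule lborel_pair.Fubini') measurable
    \<comment> \<open>For fixed \<open>y\<close>, the variable \<open>z\<close> is translated by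
      \<open>- h y\<close>, which replaces \<open>g z\<close> by \<open>g z - y\<close>. After the
      next exchange of integrals, a reflection in \<open>y\<close> separates the two
      factors.\<close>
    also have "\<dots> = (\<integral>\<^sup>+y. \<integral>\<^sup>+z. indicator E (g (- h y + 1 *\<^sub>R z)) *
        indicator F (g (- h y + 1 *\<^sub>R z) + y) \<partial>lborel \<partial>lborel)"
      by (intro nn_integral_cong nn_integral_lborel_translate_reflect[symmetric]) simp_all
    also have "\<dots> = (\<integral>\<^sup>+y. \<integral>\<^sup>+z. indicator E (g z - y) * indicator F (g z) \<partial>lborel \<partial>lborel)"
      by (simp add: linear_add[OF g] linear_diff[OF g] linear_neg[OF g] gh)
    also have "\<dots> = (\<integral>\<^sup>+z. \<integral>\<^sup>+y. indicator E (g z - y) * indicator F (g z) \<partial>lborel \<partial>lborel)"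
      by (rule lborel_pair.Fubini') measurable
    also have "\<dots> = (\<integral>\<^sup>+z. indicator F (g z) * (\<integral>\<^sup>+y. indicator E (g z + (- 1) *\<^sub>R y) \<partial>lborel) \<partial>lborel)"
      by (simp add: nn_integral_cmult mult.commute)
    also have "\<dots> = ?\<mu> F * emeasure lborel E"
      by (subst nn_integral_lborel_translate_reflect) (simp_all add: nn_integral_multc)
    finally show ?thesis .
  qed
  \<comment> \<open>The unit cube fixes the proportionality constant as the measure of its preimage,
    which is finite since the preimage is bounded.\<close>
  define Q where "Q = (cbox 0 One :: 'a set)"
  have "emeasure lborel Q = 1"
    unfolding Q_def by (simp add: emeasure_lborel_cbox_eq inner_Basis)
  have "g -` Q = h ` Q"
    using gh hg by (auto simp: image_iff) metis
  then have "bounded (g -` Q)"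
    using h by (simp add: Q_def bounded_linear_image linear_conv_bounded_linear)
  then have "emeasure lborel (g -` Q) < \<infinity>"
    by (rule emeasure_bounded_finite)
  then obtain c where c: "c \<ge> 0" "emeasure lborel (g -` Q) = ennreal c"
    by (cases "emeasure lborel (g -` Q)") auto
  have \<mu>: "?\<mu> E = emeasure lborel (g -` E)" if "E \<in> sets borel" for E
  proof -
    have "?\<mu> E = (\<integral>\<^sup>+z. indicator (g -` E) z \<partial>lborel)"
      by (intro nn_integral_cong) (auto split: split_indicator)
    then show ?thesis
      using that measurable_sets_borel[of g borel E] by simp
  qed
  have "distr lborel borel g = density lborel (\<lambda>_. ennreal c)"
  proof (rule measure_eqI)
    fix E assume "E \<in> sets (distr lborel borel g)"
    then have E: "E \<in> sets borel" by simp
    have "emeasure lborel (g -` E) = ennreal c * emeasure lborel E"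
      using proportional[OF E, of Q] \<mu>[OF E] \<mu>[of Q] c \<open>emeasure lborel Q = 1\<close> by (simp add: Q_def)
    then show "emeasure (distr lborel borel g) E = emeasure (density lborel (\<lambda>_. ennreal c)) E"
      using E by (simp add: emeasure_distr emeasure_density nn_integral_cmult_indicator)
  qed simp
  with c(1) show thesis by (rule that)
qed

text \<open>Only the independence of \<open>c\<close> from \<open>f\<close> matters here; its value
  will be absorbed into the coefficients of the exponentials.\<close>

lemma integral_lborel_linear:
  fixes g h :: "'a::euclidean_space \<Rightarrow> 'a"
  assumes "linear g" "linear h" "\<And>x. g (h x) = x" "\<And>x. h (g x) = x"
  obtains c :: real where "\<And>f :: 'a \<Rightarrow> complex. f \<in> borel_measurable borel \<Longrightarrow>
    (\<integral>x. f (w + g x) \<partial>lborel) = c *\<^sub>R (\<integral>x. f x \<partial>lborel)"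
proof -
  obtain c where c: "c \<ge> 0" "distr lborel borel g = density lborel (\<lambda>_. ennreal c)"
    using distr_lborel_linear[OF assms] .
  have [measurable]: "g \<in> borel_measurable borel"
    using assms by (auto intro!: borel_measurable_continuous_onI linear_continuous_on
        simp: linear_conv_bounded_linear)
  have "(\<integral>x. f (w + g x) \<partial>lborel) = c *\<^sub>R (\<integral>x. f x \<partial>lborel)"
    if [measurable]: "f \<in> borel_measurable borel" for f :: "'a \<Rightarrow> complex"
  proof -
    have "(\<integral>x. f (w + g x) \<partial>lborel) = (\<integral>x. f (w + x) \<partial>distr lborel borel g)"
      by (simp add: integral_distr)
    also have "\<dots> = c *\<^sub>R (\<integral>x. f (w + x) \<partial>lborel)"
      unfolding c(2) using c(1) by (subst integral_density) auto
    also have "(\<integral>x. f (w + x) \<partial>lborel) = (\<integral>x. f x \<partial>distr lborel borel ((+) w))"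
      by (simp add: integral_distr)
    finally show ?thesis
      by (simp add: lborel_distr_plus)
  qed
  then show thesis by (rule that)
qed

section \<open>Exponential integrals over simplices and polytopes\<close>

text \<open>Working with functions on an arbitrary index set, rather than with vectors, permits
  induction on the dimension by adding one coordinate at a time.\<close>

definition std_simplex_ind :: "'a set \<Rightarrow> ('a \<Rightarrow> real) \<Rightarrow> real"
  where "std_simplex_ind A x = (if (\<forall>i\<in>A. 0 \<le> x i) \<and> sum x A \<le> 1 then 1 else 0)"

lemma std_simplex_ind_measurable [measurable]:
  assumes [simp]: "finite A"
  shows "std_simplex_ind A \<in> borel_measurable (Pi\<^sub>M A (\<lambda>_. lborel))"
  unfolding std_simplex_ind_def by measurable

text \<open>The fundamental theorem of calculus. Multiplying by the frequency, instead of dividing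
  by it, covers \<open>a = 0\<close> as well.\<close>

lemma cis_integral:
  assumes "R \<ge> 0"
  shows "(\<i> * of_real a) * (\<integral>y. indicator {0..R} y *\<^sub>R cis (a * y) \<partial>lborel) = cis (a * R) - 1"
proof -
  have "(\<integral>y. indicator {0..R} y *\<^sub>R (of_real a * (\<i> * cis (a * y))) \<partial>lborel) = cis (a * R) - cis (a * 0)"
  proof (rule integral_FTC_atLeastAtMost[OF assms])
    fix x
    show "((\<lambda>x. cis (a * x)) has_vector_derivative of_real a * (\<i> * cis (a * x))) (at x within {0..R})"
    proof -
      have "((\<lambda>z. exp (\<i> * of_real a * z)) has_field_derivative of_real a * (\<i> * cis (a * x))) (at (of_real x))"
        by (auto intro!: derivative_eq_intros simp: cis_conv_exp mult_ac)
      from has_vector_derivative_real_field[OF this, of "{0..R}"] show ?thesis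
        by (simp add: cis_conv_exp mult_ac)
    qed
  next
    show "continuous_on {0..R} (\<lambda>y. of_real a * (\<i> * cis (a * y)))"
      by (intro continuous_intros)
  qed
  moreover have "(\<i> * of_real a) * (\<integral>y. indicator {0..R} y *\<^sub>R cis (a * y) \<partial>lborel) =
      (\<integral>y. indicator {0..R} y *\<^sub>R (of_real a * (\<i> * cis (a * y))) \<partial>lborel)"
    by (subst integral_mult_right_zero[symmetric]) (simp add: mult_ac)
  ultimately show ?thesis
    by simp
qed

lemma integrable_std_simplex_expo:
  fixes c :: "'a \<Rightarrow> real"
  assumes A [simp]: "finite A"
  shows "integrable (Pi\<^sub>M A (\<lambda>_. lborel)) (\<lambda>x. std_simplex_ind A x *\<^sub>R cis (t * (\<Sum>i\<in>A. c i * x i)))"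
proof (rule integrableI_bounded_set)
  let ?M = "Pi\<^sub>M A (\<lambda>_. lborel) :: ('a \<Rightarrow> real) measure"
  let ?S = "{x. (\<forall>i\<in>A. 0 \<le> x i) \<and> sum x A \<le> 1} \<inter> space ?M"
  have "?S = {x \<in> space ?M. std_simplex_ind A x = 1}"
    by (auto simp: std_simplex_ind_def)
  also have "\<dots> \<in> sets ?M"
    by measurable
  finally show "?S \<in> sets ?M" .
  show "emeasure ?M ?S < \<infinity>"
    by (subst emeasure_std_simplex_aux) (auto simp: ennreal_divide_eq_top_iff less_top[symmetric])
  show "(\<lambda>x. std_simplex_ind A x *\<^sub>R cis (t * (\<Sum>i\<in>A. c i * x i))) \<in> borel_measurable ?M"
    unfolding cis_conv_exp by measurable
  show "AE x\<in>?S in ?M. norm (std_simplex_ind A x *\<^sub>R cis (t * (\<Sum>i\<in>A. c i * x i))) \<le> 1"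
    by (auto simp: std_simplex_ind_def)
  show "AE x in ?M. x \<notin> ?S \<longrightarrow> std_simplex_ind A x *\<^sub>R cis (t * (\<Sum>i\<in>A. c i * x i)) = 0"
    by (auto simp: std_simplex_ind_def)
qed

text \<open>Integrating out the coordinate \<open>a\<close> first leaves boundary terms at its two
  endpoints: exponential integrals over the simplex on \<open>A\<close>, with coefficients
  \<open>c i - c a\<close> and \<open>c i\<close>. The numbers 0 and \<open>c i\<close> are the
  values of the functional at the vertices, and their distinctness is inherited by both
  terms.\<close>

lemma std_simplex_expo_integral:
  assumes "finite A" "inj_on c A" "0 \<notin> c ` A"
  shows "\<exists>b0 b. \<forall>t. of_real t ^ card A *
      (\<integral>x. std_simplex_ind A x *\<^sub>R cis (t * (\<Sum>i\<in>A. c i * x i)) \<partial>Pi\<^sub>M A (\<lambda>_. lborel)) =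
      b0 + (\<Sum>i\<in>A. b i * cis (t * c i))"
  using assms
proof (induction A arbitrary: c rule: finite_induct)
  case empty
  then show ?case
    by (auto simp: PiM_empty lebesgue_integral_count_space_finite std_simplex_ind_def)
next
  case (insert a A c)
  interpret product_sigma_finite "\<lambda>_::'a. lborel :: real measure"
    by standard
  define F where "F B c t = (\<integral>x. std_simplex_ind B x *\<^sub>R cis (t * (\<Sum>i\<in>B. c i * x i)) \<partial>Pi\<^sub>M B (\<lambda>_. lborel))"
    for B and c :: "'a \<Rightarrow> real" and t
  have ca: "c a \<noteq> 0"
    using insert.prems by force
  have step: "\<i> * of_real (t * c a) * F (insert a A) c t =
      cis (t * c a) * F A (\<lambda>i. c i - c a) t - F A c t" for t
  proof -
    have inner: "\<i> * of_real (t * c a) * (\<integral>y. std_simplex_ind (insert a A) (x(a := y)) *\<^sub>R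
          cis (t * (\<Sum>i\<in>insert a A. c i * (x(a := y)) i)) \<partial>lborel) =
        cis (t * c a) * (std_simplex_ind A x *\<^sub>R cis (t * (\<Sum>i\<in>A. (c i - c a) * x i))) -
          std_simplex_ind A x *\<^sub>R cis (t * (\<Sum>i\<in>A. c i * x i))" (is "?L = ?R") for x
    proof -
      let ?s = "\<Sum>i\<in>A. c i * x i" and ?r = "1 - sum x A"
      have "std_simplex_ind (insert a A) (x(a := y)) = std_simplex_ind A x * indicator {0..?r} y" for y
      proof -
        have "(\<forall>i\<in>insert a A. 0 \<le> (x(a := y)) i) \<longleftrightarrow> 0 \<le> y \<and> (\<forall>i\<in>A. 0 \<le> x i)"
          using insert.hyps by auto
        moreover have "sum (x(a := y)) (insert a A) = y + sum x A"
          using insert.hyps by (simp add: sum.insert_if) (auto intro: sum.cong)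
        ultimately show ?thesis
          by (auto simp: std_simplex_ind_def split: split_indicator)
      qed
      moreover have "(\<Sum>i\<in>insert a A. c i * (x(a := y)) i) = c a * y + ?s" for y
        using insert.hyps by (simp add: sum.insert_if) (auto intro: sum.cong)
      ultimately have "?L = \<i> * of_real (t * c a) * (\<integral>y. (std_simplex_ind A x *\<^sub>R cis (t * ?s)) *
          (indicator {0..?r} y *\<^sub>R cis (t * c a * y)) \<partial>lborel)"
        by (intro arg_cong2[of _ _ _ _ "(*)"] Bochner_Integration.integral_cong refl)
           (auto simp: cis_mult[symmetric] distrib_left mult_ac)
      also have "\<dots> = (std_simplex_ind A x *\<^sub>R cis (t * ?s)) * (\<i> * of_real (t * c a) *
          (\<integral>y. indicator {0..?r} y *\<^sub>R cis (t * c a * y) \<partial>lborel))"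
        by (subst integral_mult_right_zero) (simp only: mult_ac)
      \<comment> \<open>If the interval has negative length, \<open>cis_integral\<close> does not
        apply, but then the factor \<open>std_simplex_ind A x\<close> is zero.\<close>
      also have "\<dots> = (std_simplex_ind A x *\<^sub>R cis (t * ?s)) * (cis (t * c a * ?r) - 1)"
      proof (cases "sum x A \<le> 1")
        case True
        then show ?thesis by (subst cis_integral) simp_all
      qed (simp add: std_simplex_ind_def)
      also have "\<dots> = std_simplex_ind A x *\<^sub>R cis (t * ?s + t * c a * ?r) - std_simplex_ind A x *\<^sub>R cis (t * ?s)"
        by (simp add: right_diff_distrib cis_mult)
      also have "t * ?s + t * c a * ?r = t * c a + t * (\<Sum>i\<in>A. (c i - c a) * x i)"
        by (simp add: algebra_simps sum_subtractf sum_distrib_left)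
      finally show ?thesis
        by (simp add: cis_mult[symmetric] del: fun_upd_apply)
    qed
    have "\<i> * of_real (t * c a) * F (insert a A) c t =
       (\<integral>x. \<i> * of_real (t * c a) * (\<integral>y. std_simplex_ind (insert a A) (x(a := y)) *\<^sub>R
          cis (t * (\<Sum>i\<in>insert a A. c i * (x(a := y)) i)) \<partial>lborel) \<partial>Pi\<^sub>M A (\<lambda>_. lborel))"
      unfolding F_def using insert.hyps
      by (subst product_integral_insert[OF _ _ integrable_std_simplex_expo]) (simp_all del: fun_upd_apply)
    also have "\<dots> = cis (t * c a) * F A (\<lambda>i. c i - c a) t - F A c t"
      unfolding inner F_def
      by (subst Bochner_Integration.integral_diff)
         (rule integrable_mult_right integrable_std_simplex_expo insert.hyps(1) |
           simp only: integral_mult_right_zero)+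
    finally show ?thesis .
  qed
  obtain b0 b where b: "\<And>t. of_real t ^ card A * F A c t = b0 + (\<Sum>i\<in>A. b i * cis (t * c i))"
    using insert.IH[of c] insert.prems unfolding F_def by (auto simp: inj_on_def)
  have "inj_on (\<lambda>i. c i - c a) A" "0 \<notin> (\<lambda>i. c i - c a) ` A"
    using insert.prems insert.hyps by (auto simp: inj_on_def)
  then obtain b0' b' where b': "\<And>t. of_real t ^ card A * F A (\<lambda>i. c i - c a) t =
      b0' + (\<Sum>i\<in>A. b' i * cis (t * (c i - c a)))"
    using insert.IH[of "\<lambda>i. c i - c a"] unfolding F_def by auto
  define k where "k = \<i> * of_real (c a)"
  have k: "k \<noteq> 0"
    using ca by (simp add: k_def)
  \<comment> \<open>Multiplying by \<open>cis (t * c a)\<close> shifts the frequencies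
    \<open>c i - c a\<close> back to \<open>c i\<close> and turns the constant term
    \<open>b0'\<close> into the coefficient of the new frequency \<open>c a\<close>.\<close>
  define b'' where "b'' i = (if i = a then b0' / k else (b' i - b i) / k)" for i
  have "of_real t ^ card (insert a A) * F (insert a A) c t = - b0 / k + (\<Sum>i\<in>insert a A. b'' i * cis (t * c i))" for t
  proof -
    have "k * (of_real t ^ card (insert a A) * F (insert a A) c t) =
        of_real t ^ card A * (\<i> * of_real (t * c a) * F (insert a A) c t)"
      using insert.hyps by (simp add: k_def)
    also have "\<dots> = cis (t * c a) * (of_real t ^ card A * F A (\<lambda>i. c i - c a) t) - of_real t ^ card A * F A c t"
      unfolding step by (simp add: algebra_simps)
    also have "\<dots> = b0' * cis (t * c a) + (\<Sum>i\<in>A. b' i * (cis (t * c a) * cis (t * (c i - c a)))) -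
        b0 - (\<Sum>i\<in>A. b i * cis (t * c i))"
      unfolding b b' by (simp add: algebra_simps sum_distrib_left)
    also have "\<dots> = - b0 + b0' * cis (t * c a) + (\<Sum>i\<in>A. (b' i - b i) * cis (t * c i))"
      by (simp add: cis_mult algebra_simps sum_subtractf)
    also have "(\<Sum>i\<in>A. (b' i - b i) * cis (t * c i)) = (\<Sum>i\<in>A. k * (b'' i * cis (t * c i)))"
      using insert.hyps k by (intro sum.cong) (auto simp: b''_def)
    also have "- b0 + b0' * cis (t * c a) + \<dots> = k * (- b0 / k + (\<Sum>i\<in>insert a A. b'' i * cis (t * c i)))"
      using insert.hyps k by (simp add: b''_def sum_distrib_left field_simps)
    finally show ?thesis
      using k by simp
  qed
  then show ?case
    unfolding F_def by blast
qed

text \<open>An affine bijection carries the standard simplex to \<open>convex hull T\<close>. It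
  contributes a constant factor and the phase of the base vertex \<open>w\<close>; the remaining
  frequencies are the differences of \<open>\<omega> \<bullet> u\<close> from the value at
  \<open>w\<close>.\<close>

lemma simplex_expo_integral:
  fixes T :: "'a::euclidean_space set"
  assumes indep: "\<not> affine_dependent T" and card: "card T = Suc DIM('a)" and inj: "inj_on ((\<bullet>) \<omega>) T"
  shows "\<exists>b. \<forall>t. of_real t ^ DIM('a) *
      (\<integral>x. indicator (convex hull T) x *\<^sub>R cis (t * (\<omega> \<bullet> x)) \<partial>lborel) =
      (\<Sum>u\<in>T. b u * cis (t * (\<omega> \<bullet> u)))"
proof -
  have fin: "finite T" and "T \<noteq> {}"
    using card by (auto intro: card_ge_0_finite)
  then obtain w where w: "w \<in> T" by blast
  have "card (T - {w}) = DIM('a)"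
    using card w fin by simp
  then obtain \<beta> where \<beta>: "bij_betw \<beta> (Basis :: 'a set) (T - {w})"
    using finite_same_card_bij[of Basis "T - {w}"] fin by auto
  \<comment> \<open>The linear map sending the basis vectors to the edge vectors at
    \<open>w\<close>; thus \<open>w + g x\<close> parametrizes the simplex.\<close>
  define g where "g x = (\<Sum>b\<in>Basis. (x \<bullet> b) *\<^sub>R (\<beta> b - w))" for x :: 'a
  have g: "linear g"
    unfolding g_def by (intro linearI) (auto simp: inner_add_left scaleR_left_distrib sum.distrib scaleR_sum_right)
  have g_Basis: "g b = \<beta> b - w" if "b \<in> Basis" for b
    unfolding g_def using that by (simp add: inner_Basis if_distrib[of "\<lambda>r. r *\<^sub>R _"] cong: if_cong)
  have g_im: "g ` Basis = (\<lambda>x. - w + x) ` (T - {w})"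
    using g_Basis bij_betw_imp_surj_on[OF \<beta>] by (force simp: image_iff)
  have "independent (g ` Basis)"
    unfolding g_im using affine_dependent_iff_dependent2[OF w] indep by blast
  moreover have "card (g ` Basis) = DIM('a)"
    unfolding g_im using \<open>card (T - {w}) = DIM('a)\<close> by (simp add: card_image)
  ultimately have "UNIV \<subseteq> span (g ` Basis)"
    by (intro card_ge_dim_independent) auto
  then have "surj g"
    by (simp add: linear_span_image[OF g] top.extremum_unique)
  then have "inj g"
    using g linear_surjective_imp_injective by blast
  then obtain h where h: "linear h" "\<And>x. h (g x) = x" "\<And>x. g (h x) = x"
    using linear_injective_isomorphism[OF g] by blast
  define \<Delta> where "\<Delta> = convex hull (insert 0 Basis :: 'a set)"
  have "(+) w ` g ` \<Delta> = convex hull ((+) w ` g ` insert 0 Basis)"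
    by (simp only: \<Delta>_def convex_hull_linear_image[OF g] convex_hull_translation)
  also have "(+) w ` g ` insert 0 Basis = T"
    using w by (auto simp: g_im linear_0[OF g] image_iff)
  finally have hull: "convex hull T = (+) w ` g ` \<Delta>" by simp
  have mem: "x \<in> convex hull T \<longleftrightarrow> - h w + h x \<in> \<Delta>" for x
  proof -
    have "x \<in> (+) w ` g ` \<Delta> \<longleftrightarrow> (\<exists>y\<in>\<Delta>. x = w + g y)" by auto
    also have "\<dots> \<longleftrightarrow> - h w + h x \<in> \<Delta>"
    proof
      assume "\<exists>y\<in>\<Delta>. x = w + g y"
      then show "- h w + h x \<in> \<Delta>"
        by (auto simp: linear_add[OF h(1)] h(2))
    next
      assume "- h w + h x \<in> \<Delta>"
      moreover have "x = w + g (- h w + h x)"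
        by (simp add: linear_add[OF g] linear_diff[OF g] linear_neg[OF g] h(3))
      ultimately show "\<exists>y\<in>\<Delta>. x = w + g y" by blast
    qed
    finally show ?thesis unfolding hull .
  qed
  have \<Delta>_meas [measurable]: "\<Delta> \<in> sets borel"
    unfolding \<Delta>_def by (intro borel_closed compact_imp_closed finite_imp_compact_convex_hull) simp
  have [measurable]: "g \<in> borel_measurable borel"
    using g by (auto intro!: borel_measurable_continuous_onI linear_continuous_on simp: linear_conv_bounded_linear)
  obtain c :: real where c: "\<And>f :: 'a \<Rightarrow> complex. f \<in> borel_measurable borel \<Longrightarrow>
      (\<integral>x. f (- h w + h x) \<partial>lborel) = c *\<^sub>R (\<integral>x. f x \<partial>lborel)"
    using integral_lborel_linear[OF h(1) g h(2,3)] by blast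
  define d where "d b = \<omega> \<bullet> (\<beta> b - w)" for b
  have \<beta>_T: "\<beta> b \<in> T" "\<beta> b \<noteq> w" if "b \<in> Basis" for b
    using \<beta> that by (auto simp: bij_betw_def)
  have "inj_on d Basis"
  proof (rule inj_onI)
    fix b b' assume b: "b \<in> Basis" "b' \<in> Basis" "d b = d b'"
    then have "\<beta> b = \<beta> b'"
      using inj \<beta>_T by (auto simp: d_def inner_diff_right inj_on_def)
    with b \<beta> show "b = b'" by (auto simp: bij_betw_def inj_on_def)
  qed
  moreover have "0 \<notin> d ` Basis"
    using inj \<beta>_T w by (force simp: d_def inner_diff_right inj_on_def)
  ultimately obtain b0 b where b: "\<And>t. of_real t ^ DIM('a) *
      (\<integral>x. std_simplex_ind Basis x *\<^sub>R cis (t * (\<Sum>i\<in>Basis. d i * x i)) \<partial>Pi\<^sub>M Basis (\<lambda>_. lborel)) =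
      b0 + (\<Sum>i\<in>Basis. b i * cis (t * d i))"
    using std_simplex_expo_integral[of Basis d] by auto
  have int_eq: "(\<integral>x. indicator (convex hull T) x *\<^sub>R cis (t * (\<omega> \<bullet> x)) \<partial>lborel) =
      of_real c * cis (t * (\<omega> \<bullet> w)) *
      (\<integral>x. std_simplex_ind Basis x *\<^sub>R cis (t * (\<Sum>i\<in>Basis. d i * x i)) \<partial>Pi\<^sub>M Basis (\<lambda>_. lborel))" for t
  proof -
    define f where "f y = indicator \<Delta> y *\<^sub>R cis (t * (\<omega> \<bullet> (w + g y)))" for y
    have f_meas [measurable]: "f \<in> borel_measurable borel"
      unfolding f_def cis_conv_exp by measurable
    have "(\<integral>x. indicator (convex hull T) x *\<^sub>R cis (t * (\<omega> \<bullet> x)) \<partial>lborel) = (\<integral>x. f (- h w + h x) \<partial>lborel)"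
      unfolding f_def
      by (intro Bochner_Integration.integral_cong)
         (auto simp: mem linear_add[OF g] linear_diff[OF g] linear_neg[OF g] h(3) split: split_indicator)
    also have "\<dots> = c *\<^sub>R (\<integral>x. f x \<partial>lborel)"
      by (rule c) measurable
    also have "(\<integral>x. f x \<partial>lborel) = (\<integral>y. f (\<Sum>b\<in>Basis. y b *\<^sub>R b) \<partial>Pi\<^sub>M Basis (\<lambda>_. lborel))"
      by (subst lborel_eq) (simp add: integral_distr)
    also have "\<dots> = (\<integral>y. cis (t * (\<omega> \<bullet> w)) * (std_simplex_ind Basis y *\<^sub>R cis (t * (\<Sum>i\<in>Basis. d i * y i)))
        \<partial>Pi\<^sub>M Basis (\<lambda>_. lborel))"
    proof (rule Bochner_Integration.integral_cong[OF refl])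
      fix y :: "'a \<Rightarrow> real"
      have "indicator \<Delta> (\<Sum>b\<in>Basis. y b *\<^sub>R b) = std_simplex_ind Basis y"
        unfolding \<Delta>_def std_simplex std_simplex_ind_def
        by (auto split: split_indicator)
      moreover have "\<omega> \<bullet> (w + g (\<Sum>b\<in>Basis. y b *\<^sub>R b)) = \<omega> \<bullet> w + (\<Sum>i\<in>Basis. d i * y i)"
        by (simp add: g_def d_def inner_add_right inner_sum_right mult.commute)
      ultimately show "f (\<Sum>b\<in>Basis. y b *\<^sub>R b) =
          cis (t * (\<omega> \<bullet> w)) * (std_simplex_ind Basis y *\<^sub>R cis (t * (\<Sum>i\<in>Basis. d i * y i)))"
        by (simp add: f_def cis_mult distrib_left)
    qed
    finally show ?thesis
      by (simp add: scaleR_conv_of_real mult.assoc)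
  qed
  define \<beta>' where "\<beta>' = inv_into Basis \<beta>"
  \<comment> \<open>The constant term \<open>b0\<close> belongs to the origin of the standard
    simplex, which is mapped to \<open>w\<close>.\<close>
  define b' where "b' u = (if u = w then of_real c * b0 else of_real c * b (\<beta>' u))" for u
  have "of_real t ^ DIM('a) * (\<integral>x. indicator (convex hull T) x *\<^sub>R cis (t * (\<omega> \<bullet> x)) \<partial>lborel) =
      (\<Sum>u\<in>T. b' u * cis (t * (\<omega> \<bullet> u)))" for t
  proof -
    have "(\<Sum>u\<in>T. b' u * cis (t * (\<omega> \<bullet> u))) =
        b' w * cis (t * (\<omega> \<bullet> w)) + (\<Sum>u\<in>T - {w}. b' u * cis (t * (\<omega> \<bullet> u)))"
      using fin w by (rule sum.remove)
    also have "(\<Sum>u\<in>T - {w}. b' u * cis (t * (\<omega> \<bullet> u))) = (\<Sum>i\<in>Basis. b' (\<beta> i) * cis (t * (\<omega> \<bullet> \<beta> i)))"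
      by (rule sum.reindex_bij_betw[OF \<beta>, symmetric])
    also have "\<dots> = (\<Sum>i\<in>Basis. of_real c * cis (t * (\<omega> \<bullet> w)) * (b i * cis (t * d i)))"
    proof (rule sum.cong[OF refl])
      fix i :: 'a assume i: "i \<in> Basis"
      have "b' (\<beta> i) = of_real c * b i"
        using \<beta>_T[OF i] i \<beta> by (simp add: b'_def \<beta>'_def bij_betw_def inv_into_f_f)
      moreover have "cis (t * (\<omega> \<bullet> \<beta> i)) = cis (t * (\<omega> \<bullet> w)) * cis (t * d i)"
        by (simp add: cis_mult d_def inner_diff_right algebra_simps)
      ultimately show "b' (\<beta> i) * cis (t * (\<omega> \<bullet> \<beta> i)) = of_real c * cis (t * (\<omega> \<bullet> w)) * (b i * cis (t * d i))"
        by simp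
    qed
    also have "b' w * cis (t * (\<omega> \<bullet> w)) + \<dots> =
        of_real c * cis (t * (\<omega> \<bullet> w)) * (b0 + (\<Sum>i\<in>Basis. b i * cis (t * d i)))"
      by (simp add: b'_def distrib_left sum_distrib_left)
    also have "\<dots> = of_real t ^ DIM('a) * (\<integral>x. indicator (convex hull T) x *\<^sub>R cis (t * (\<omega> \<bullet> x)) \<partial>lborel)"
      unfolding int_eq b[symmetric] by simp
    finally show ?thesis by simp
  qed
  then show ?thesis by blast
qed

lemma integrable_expo:
  fixes K :: "'a::euclidean_space set"
  assumes "compact K"
  shows "integrable lborel (\<lambda>x. indicator K x *\<^sub>R cis (t * (\<omega> \<bullet> x)))"
  using assms by (intro borel_integrable_compact continuous_intros)

text \<open>The formula is additive over a triangulation. Since its simplices have all their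
  vertices in \<open>V\<close>, no new frequencies appear and injectivity on \<open>V\<close>
  suffices for each simplex.\<close>

lemma polytope_expo_integral:
  fixes V :: "'a::euclidean_space set"
  assumes V: "finite V" and inj: "inj_on ((\<bullet>) \<omega>) V"
  shows "\<exists>b. \<forall>t. of_real t ^ DIM('a) *
      (\<integral>x. indicator (convex hull V) x *\<^sub>R cis (t * (\<omega> \<bullet> x)) \<partial>lborel) =
      (\<Sum>u\<in>V. b u * cis (t * (\<omega> \<bullet> u)))"
proof -
  obtain \<T> N where \<T>: "\<And>T. T \<in> \<T> \<Longrightarrow> T \<subseteq> V \<and> \<not> affine_dependent T \<and> card T = Suc DIM('a)"
    and N: "N \<in> null_sets lborel"
    and unique: "\<And>x T T'. \<lbrakk>T \<in> \<T>; T' \<in> \<T>; x \<in> convex hull T; x \<in> convex hull T'; x \<notin> N\<rbrakk> \<Longrightarrow> T = T'"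
    and cover: "\<And>x. \<lbrakk>x \<in> convex hull V; x \<notin> N\<rbrakk> \<Longrightarrow> \<exists>T\<in>\<T>. x \<in> convex hull T"
    by (rule regular_triangulation[OF V]) (rule that)
  have fin: "finite \<T>"
    by (rule finite_subset[of _ "Pow V"]) (use \<T> V in \<open>blast, simp\<close>)
  have finT: "finite T" if "T \<in> \<T>" for T
    using \<T>[OF that] finite_subset[OF _ V] by simp
  define I where "I T t = of_real t ^ DIM('a) *
      (\<integral>x. indicator (convex hull T) x *\<^sub>R cis (t * (\<omega> \<bullet> x)) \<partial>lborel)" for T :: "'a set" and t
  have "\<exists>b. \<forall>t. I T t = (\<Sum>u\<in>T. b u * cis (t * (\<omega> \<bullet> u)))" if "T \<in> \<T>" for T
    unfolding I_def
    by (rule simplex_expo_integral) (use \<T>[OF that] inj_on_subset[OF inj] in simp_all)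
  then obtain b where b: "\<And>T t. T \<in> \<T> \<Longrightarrow> I T t = (\<Sum>u\<in>T. b T u * cis (t * (\<omega> \<bullet> u)))"
    by metis
  \<comment> \<open>Overlaps and gaps of the triangulation lie in the null set \<open>N\<close>, so
    this equality off \<open>N\<close> is enough for the integrals.\<close>
  have ind: "indicator (convex hull V) x = (\<Sum>T\<in>\<T>. indicator (convex hull T) x :: real)" if x: "x \<notin> N" for x
  proof (cases "x \<in> convex hull V")
    case True
    then obtain T where T: "T \<in> \<T>" "x \<in> convex hull T"
      using cover x by blast
    have "x \<in> convex hull T' \<longleftrightarrow> T' = T" if "T' \<in> \<T>" for T'
      using unique[OF that T(1) _ T(2) x] T(2) by blast
    then have "(\<Sum>T\<in>\<T>. indicator (convex hull T) x :: real) = (\<Sum>T'\<in>\<T>. if T' = T then 1 else 0)"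
      by (intro sum.cong) (simp_all add: indicator_def)
    with T True fin show ?thesis by simp
  next
    case False
    then have "x \<notin> convex hull T" if "T \<in> \<T>" for T
      using \<T>[OF that] hull_mono[of T V] by blast
    with False show ?thesis by (simp add: indicator_def)
  qed
  \<comment> \<open>The coefficient of a vertex collects the contributions of all simplices that
    contain it.\<close>
  define B where "B u = (\<Sum>T\<in>\<T>. if u \<in> T then b T u else 0)" for u
  have "of_real t ^ DIM('a) * (\<integral>x. indicator (convex hull V) x *\<^sub>R cis (t * (\<omega> \<bullet> x)) \<partial>lborel) =
      (\<Sum>u\<in>V. B u * cis (t * (\<omega> \<bullet> u)))" for t
  proof -
    have int: "integrable lborel (\<lambda>x. indicator (convex hull T) x *\<^sub>R cis (t * (\<omega> \<bullet> x)))" if "finite T" for T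
      using that by (intro integrable_expo finite_imp_compact_convex_hull)
    have "(\<integral>x. indicator (convex hull V) x *\<^sub>R cis (t * (\<omega> \<bullet> x)) \<partial>lborel) =
        (\<integral>x. (\<Sum>T\<in>\<T>. indicator (convex hull T) x *\<^sub>R cis (t * (\<omega> \<bullet> x))) \<partial>lborel)"
    proof (rule integral_cong_AE)
      show "AE x in lborel. indicator (convex hull V) x *\<^sub>R cis (t * (\<omega> \<bullet> x)) =
          (\<Sum>T\<in>\<T>. indicator (convex hull T) x *\<^sub>R cis (t * (\<omega> \<bullet> x)))"
        using AE_not_in[OF N] by eventually_elim (simp add: ind scaleR_sum_left)
    next
      show "(\<lambda>x. indicator (convex hull V) x *\<^sub>R cis (t * (\<omega> \<bullet> x))) \<in> borel_measurable lborel"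
        using int[OF V] by (rule borel_measurable_integrable)
      show "(\<lambda>x. \<Sum>T\<in>\<T>. indicator (convex hull T) x *\<^sub>R cis (t * (\<omega> \<bullet> x))) \<in> borel_measurable lborel"
        by (rule borel_measurable_sum) (rule borel_measurable_integrable[OF int[OF finT]])
    qed
    also have "\<dots> = (\<Sum>T\<in>\<T>. \<integral>x. indicator (convex hull T) x *\<^sub>R cis (t * (\<omega> \<bullet> x)) \<partial>lborel)"
      using int finT by (intro Bochner_Integration.integral_sum) auto
    also have "of_real t ^ DIM('a) * \<dots> = (\<Sum>T\<in>\<T>. \<Sum>u\<in>T. b T u * cis (t * (\<omega> \<bullet> u)))"
      unfolding sum_distrib_left using b by (intro sum.cong) (simp_all add: I_def)
    also have "\<dots> = (\<Sum>T\<in>\<T>. \<Sum>u\<in>V. (if u \<in> T then b T u else 0) * cis (t * (\<omega> \<bullet> u)))"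
      using \<T> V by (intro sum.cong sum.mono_neutral_cong_left) auto
    also have "\<dots> = (\<Sum>u\<in>V. B u * cis (t * (\<omega> \<bullet> u)))"
      unfolding B_def sum_distrib_right by (rule sum.swap)
    finally show ?thesis .
  qed
  then show ?thesis by blast
qed

section \<open>Vanishing weighted power sums and the conclusion\<close>

text \<open>A Lagrange-type polynomial \<open>p\<close>, vanishing at every node except
  \<open>z w\<close>, isolates the single weight \<open>b w\<close>.\<close>

lemma power_sums_zero_imp_coeffs_zero:
  fixes b z :: "'a \<Rightarrow> 'b::idom"
  assumes V: "finite V" and inj: "inj_on z V" and nz: "\<And>v. v \<in> V \<Longrightarrow> z v \<noteq> 0"
    and sums: "\<And>k::nat. 0 < k \<Longrightarrow> (\<Sum>v\<in>V. b v * z v ^ k) = 0" and w: "w \<in> V"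
  shows "b w = 0"
proof -
  define p where "p = (\<Prod>u\<in>V - {w}. [:- z u, 1:])"
  \<comment> \<open>The extra factor \<open>z v\<close> raises all exponents to at least 1, where
    the sums are known to vanish; it is cancelled at the end because the nodes are nonzero.\<close>
  have "(\<Sum>v\<in>V. b v * z v * poly p (z v)) = (\<Sum>v\<in>V. \<Sum>i\<le>degree p. coeff p i * (b v * z v ^ Suc i))"
    by (simp add: poly_altdef sum_distrib_left mult_ac)
  also have "\<dots> = (\<Sum>i\<le>degree p. coeff p i * (\<Sum>v\<in>V. b v * z v ^ Suc i))"
    by (subst sum.swap) (simp add: sum_distrib_left)
  also have "\<dots> = 0"
    using sums by (simp del: power_Suc)
  also have "(\<Sum>v\<in>V. b v * z v * poly p (z v)) = (\<Sum>v\<in>V. if v = w then b w * z w * poly p (z w) else 0)"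
    using V by (intro sum.cong) (auto simp: p_def poly_prod)
  finally have "b w * z w * poly p (z w) = 0"
    using V w by simp
  moreover have "poly p (z w) \<noteq> 0"
    using V w inj by (auto simp: p_def poly_prod inj_on_def)
  ultimately show ?thesis
    using nz w by auto
qed

text \<open>Dominated convergence, with the indicator of \<open>K\<close> as majorant. The limit is
  needed because the identity for \<open>t ^ d\<close> times the integral says nothing about the
  integral at \<open>t = 0\<close>.\<close>

lemma expo_integral_tendsto_volume:
  fixes K :: "'a::euclidean_space set"
  assumes "compact K"
  shows "(\<lambda>n. \<integral>x. indicator K x *\<^sub>R cis (inverse (real (Suc n)) * (\<omega> \<bullet> x)) \<partial>lborel)
    \<longlonglongrightarrow> of_real (measure lborel K)"
proof -
  have [measurable]: "K \<in> sets borel"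
    using assms by (rule borel_compact)
  have meas: "(\<lambda>x. indicator K x *\<^sub>R cis (s * (\<omega> \<bullet> x))) \<in> borel_measurable borel" for s
    unfolding cis_conv_exp by measurable
  have "(\<lambda>n. \<integral>x. indicator K x *\<^sub>R cis (inverse (real (Suc n)) * (\<omega> \<bullet> x)) \<partial>lborel)
    \<longlonglongrightarrow> (\<integral>x. indicator K x *\<^sub>R cis (0 * (\<omega> \<bullet> x)) \<partial>lborel)"
  proof (rule integral_dominated_convergence[where w = "indicator K"])
    show "integrable lborel (indicator K :: 'a \<Rightarrow> real)"
      using borel_integrable_compact[OF assms, of "\<lambda>_. 1 :: real"] by simp
    show "AE x in lborel. (\<lambda>n. indicator K x *\<^sub>R cis (inverse (real (Suc n)) * (\<omega> \<bullet> x)))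
        \<longlonglongrightarrow> indicator K x *\<^sub>R cis (0 * (\<omega> \<bullet> x))"
      unfolding cis_conv_exp
      by (intro AE_I2 tendsto_intros LIMSEQ_inverse_real_of_nat)
    show "AE x in lborel. norm (indicator K x *\<^sub>R cis (inverse (real (Suc n)) * (\<omega> \<bullet> x))) \<le> indicator K x" for n
      by (auto split: split_indicator)
  qed (simp_all only: measurable_lborel2 meas)
  also have "(\<integral>x. indicator K x *\<^sub>R cis (0 * (\<omega> \<bullet> x)) \<partial>lborel) = of_real (measure lborel K)"
    using borel_compact[OF assms] by (simp add: scaleR_conv_of_real)
  finally show ?thesis .
qed

lemma scale_of_nat_in_lattice:
  assumes "lattice_of_rank m \<Lambda>" "\<omega> \<in> \<Lambda>"
  shows "real k *\<^sub>R \<omega> \<in> \<Lambda>"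
proof -
  obtain b where \<Lambda>: "\<Lambda> = {\<Sum>j<m. real_of_int (n j) *\<^sub>R b j | n :: nat \<Rightarrow> int. True}"
    using assms(1) by (auto simp: lattice_of_rank_def)
  then obtain n :: "nat \<Rightarrow> int" where "\<omega> = (\<Sum>j<m. real_of_int (n j) *\<^sub>R b j)"
    using assms(2) by auto
  then have "real k *\<^sub>R \<omega> = (\<Sum>j<m. real_of_int (int k * n j) *\<^sub>R b j)"
    by (simp add: scaleR_sum_right)
  then show ?thesis
    unfolding \<Lambda> by - (rule CollectI, rule exI, rule conjI, assumption, rule TrueI)
qed

theorem theorem2p4:
  fixes P \<Lambda> :: "(real ^ 'd) set" and m :: nat
  assumes "simple_convex_polytope P"
    and "1 \<le> m" and "m \<le> CARD('d)"
    and "lattice_of_rank m \<Lambda>"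
    and "infinite (expo ` \<Lambda>)"
    and "orthogonal_exponentials P \<Lambda>"
  shows "\<forall>\<omega>\<^sub>0 \<in> \<Lambda> - {0}. \<exists>v v'. v extreme_point_of P \<and> v' extreme_point_of P \<and> v \<noteq> v' \<and>
    (\<exists>m' :: int. \<omega>\<^sub>0 \<bullet> (v - v') = 2 * pi * real_of_int m')"
proof (rule ballI, rule ccontr)
  fix \<omega> assume \<omega>: "\<omega> \<in> \<Lambda> - {0}"
    and contr: "\<not> (\<exists>v v'. v extreme_point_of P \<and> v' extreme_point_of P \<and> v \<noteq> v' \<and>
      (\<exists>m' :: int. \<omega> \<bullet> (v - v') = 2 * pi * real_of_int m'))"
  define V where "V = {v. v extreme_point_of P}"
  have P: "polytope P" "emeasure lborel P > 0"
    using assms(1) by (auto simp: simple_convex_polytope_def convex_polytope_def)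
  have "compact P"
    using P(1) by (rule polytope_imp_compact)
  have V: "finite V"
    unfolding V_def by (rule finite_polyhedron_extreme_points[OF polytope_imp_polyhedron[OF P(1)]])
  have PV: "P = convex hull V"
    unfolding V_def using \<open>compact P\<close> P(1) by (intro Krein_Milman_Minkowski polytope_imp_convex)
  \<comment> \<open>The powers \<open>z v ^ k\<close> are the exponentials at \<open>t = k\<close>,
    and \<open>z v = z v'\<close> holds exactly when the two inner products agree modulo
    \<open>2 * pi\<close>.\<close>
  define z where "z v = cis (\<omega> \<bullet> v)" for v
  have inj: "inj_on z V"
  proof (rule inj_onI)
    fix v v' assume v: "v \<in> V" "v' \<in> V" "z v = z v'"
    then have "exp (\<i> * of_real (\<omega> \<bullet> v)) = exp (\<i> * of_real (\<omega> \<bullet> v'))"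
      by (simp add: z_def cis_conv_exp)
    then obtain n :: int where "\<i> * of_real (\<omega> \<bullet> v) = \<i> * of_real (\<omega> \<bullet> v') + of_int (2 * n) * of_real pi * \<i>"
      unfolding exp_eq by auto
    then have "Im (\<i> * of_real (\<omega> \<bullet> v)) = Im (\<i> * of_real (\<omega> \<bullet> v') + of_int (2 * n) * of_real pi * \<i>)"
      by (rule arg_cong)
    then have "\<omega> \<bullet> (v - v') = 2 * pi * real_of_int n"
      by (simp add: inner_diff_right)
    with contr v show "v = v'"
      by (auto simp: V_def)
  qed
  have "inj_on ((\<bullet>) \<omega>) V"
    using inj by (auto simp: inj_on_def z_def)
  define f where "f t = (\<integral>x. indicator P x *\<^sub>R cis (t * (\<omega> \<bullet> x)) \<partial>lborel)" for t
  obtain b where b: "\<And>t. of_real t ^ CARD('d) * f t = (\<Sum>v\<in>V. b v * cis (t * (\<omega> \<bullet> v)))"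
    using polytope_expo_integral[OF V \<open>inj_on ((\<bullet>) \<omega>) V\<close>] unfolding PV f_def by auto
  \<comment> \<open>Orthogonality is applied to the lattice points
    \<open>k *\<^sub>R \<omega>\<close> and 0.\<close>
  have f_k: "f (real k) = 0" if "0 < k" for k
  proof -
    have "real k *\<^sub>R \<omega> \<in> \<Lambda>" "0 \<in> \<Lambda>" "real k *\<^sub>R \<omega> \<noteq> 0"
      using scale_of_nat_in_lattice[OF assms(4), of \<omega>] scale_of_nat_in_lattice[OF assms(4), of \<omega> 0] \<omega> that
      by auto
    then have "(LINT x:P|lborel. expo (real k *\<^sub>R \<omega> - 0) x) = 0"
      using assms(6) unfolding orthogonal_exponentials_def by blast
    then show ?thesis
      by (simp add: f_def set_lebesgue_integral_def expo_def cis_conv_exp)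
  qed
  have b_zero: "b v = 0" if "v \<in> V" for v
  proof (rule power_sums_zero_imp_coeffs_zero[OF V inj _ _ that])
    fix k :: nat assume "0 < k"
    then show "(\<Sum>v\<in>V. b v * z v ^ k) = 0"
      using b[of "real k"] f_k by (simp add: z_def Complex.DeMoivre)
  qed (simp add: z_def)
  \<comment> \<open>With all coefficients zero, the identity gives \<open>f t = 0\<close> for every
    nonzero real \<open>t\<close>; these values approach 0.\<close>
  have "f (inverse (real (Suc n))) = 0" for n
    using b[of "inverse (real (Suc n))"] b_zero by (simp del: of_nat_Suc)
  moreover have "(\<lambda>n. f (inverse (real (Suc n)))) \<longlonglongrightarrow> of_real (measure lborel P)"
    unfolding f_def by (rule expo_integral_tendsto_volume[OF \<open>compact P\<close>])
  ultimately have "measure lborel P = 0"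
    by (simp add: LIMSEQ_const_iff)
  moreover have "emeasure lborel P < \<infinity>"
    using \<open>compact P\<close> by (intro emeasure_bounded_finite compact_imp_bounded)
  ultimately show False
    using P(2) by (simp add: emeasure_eq_ennreal_measure)
qed

end
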